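(* Let $A(\mathbf{u})=\{a^k_j\}_{j,k\in\mathbb{Z}}$ be the infinite matrix of the hydrodynamic chain $\mathbf{u}_t=A(\mathbf{u})\,\mathbf{u}_x$ for $\mathbf{u}=(u^k)_{k\in\mathbb{Z}}$ given by $$u^{k}_{t} =\left( (k+2) u^{k+1} - k u^{k-1} + u^{1} u^{k} \right) u^{0}_{x} + u^{0} u^{k} u^{1}_{x} + u^{0} u^{k-1}_{x} + u^{0} u^{k+1}_{x}\quad (k<0),$$ $$u^{0}_{t} =u^{0} u^{1} u^{0}_{x} + (u^{0})^{2} u^{1}_{x} + u^{0} u^{-1}_{x},$$ $$u^{1}_{t} = \left(2 u^{2} - (u^{1})^{2} \right) u^{0}_{x} - u^{0} u^{1} u^{1}_{x} + u^{0} u^{2}_{x},$$ $$u^{k}_{t} = \left( (k+1) u^{k+1} - (k-1) u^{k-1} - u^{1} u^{k} \right) u^{0}_{x} - u^{0} u^{k} u^{1}_{x} + u^{0} u^{k-1}_{x} + u^{0} u^{k+1}_{x}\quad (k>1).$$ Then the Haantjes tensor of $A(\mathbf{u})$ vanishes, that is, $H^i_{jk}=0$ for all $i,j,k\in\mathbb{Z}$.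
   Context: Here $\mathbf{u}=(u^k)_{k\in\mathbb{Z}}$ is a vector with infinitely many components $u^k=u^k(x,t)$; superscripts on $u$ label components (so $(u^0)^2$ denotes the square of $u^0$), and subscripts $x,t$ denote partial derivatives. The entry $a^k_j=a^k_j(\mathbf{u})$ (row $k$, column $j$) is the total coefficient of $u^j_x$ on the right-hand side of the equation for $u^k_t$, contributions from several terms containing the same $u^j_x$ being added. Each row of $A$ has finitely many nonzero entries and each entry depends on finitely many of the variables $u^k$. For such an infinite matrix, with summation over repeated indices ranging over $\mathbb{Z}$ and the $u^k$ regarded as independent variables when differentiating entries of $A$, the Nijenhuis tensor is $$N^{i}_{jk} = a^{p}_{j} \,\partial_{u^{p}} a^{i}_{k} -a^{p}_{k} \,\partial_{u^{p}} a^{i}_{j} - a^{i}_{p} \left(\partial_{u^{j}} a^{p}_{k} -\partial_{u^{k}} a^{p}_{j} \right),$$ and the Haantjes tensor is $$H^{i}_{jk} = N^{i}_{pr} \, a^{p}_{j} \, a^{r}_{k} - N^{p}_{jr} \, a^{i}_{p} \, a^{r}_{k} - N^{p}_{rk} \, a^{i}_{p} \, a^{r}_{j} + N^{p}_{jk} \, a^{i}_{r} \, a^{r}_{p}.$$ All the sums involved here are finite. *)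

theory Defs
  imports "HOL-Analysis.Analysis" "HOL-Library.Groups_Big_Fun"
begin

text \<open>
  A point is a sequence \<open>u :: int \<Rightarrow> 'a\<close>, and \<open>A u i j\<close> is the entry of the matrix \<open>A(u)\<close> in row
  \<open>i\<close> (upper index) and column \<open>j\<close> (lower index). The scalars \<open>'a :: real_normed_field\<close> cover
  both the real and the complex numbers.

  Summation over repeated indices is \<^const>\<open>Sum_any\<close>, the sum of a finitely supported family. It
  returns 0 on infinite supports; the lemmas \<open>finite_nijenhuis_sums\<close> and \<open>finite_haantjes_sums\<close>
  below show that this never happens for the matrix considered here.
\<close>

definition partial :: "int \<Rightarrow> ((int \<Rightarrow> 'a) \<Rightarrow> 'a) \<Rightarrow> (int \<Rightarrow> 'a) \<Rightarrow> 'a :: real_normed_field" where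
  "partial p f u = deriv (\<lambda>s. f (u(p := s))) (u p)"

definition nijenhuis ::
    "((int \<Rightarrow> 'a) \<Rightarrow> int \<Rightarrow> int \<Rightarrow> 'a) \<Rightarrow> (int \<Rightarrow> 'a) \<Rightarrow> int \<Rightarrow> int \<Rightarrow> int \<Rightarrow> 'a :: real_normed_field" where
  "nijenhuis A u i j k =
      Sum_any (\<lambda>p. A u p j * partial p (\<lambda>v. A v i k) u)
    - Sum_any (\<lambda>p. A u p k * partial p (\<lambda>v. A v i j) u)
    - Sum_any (\<lambda>p. A u i p * (partial j (\<lambda>v. A v p k) u - partial k (\<lambda>v. A v p j) u))"

definition haantjes ::
    "((int \<Rightarrow> 'a) \<Rightarrow> int \<Rightarrow> int \<Rightarrow> 'a) \<Rightarrow> (int \<Rightarrow> 'a) \<Rightarrow> int \<Rightarrow> int \<Rightarrow> int \<Rightarrow> 'a :: real_normed_field" where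
  "haantjes A u i j k =
      Sum_any (\<lambda>p. Sum_any (\<lambda>r. nijenhuis A u i p r * A u p j * A u r k))
    - Sum_any (\<lambda>p. Sum_any (\<lambda>r. nijenhuis A u p j r * A u i p * A u r k))
    - Sum_any (\<lambda>p. Sum_any (\<lambda>r. nijenhuis A u p r k * A u i p * A u r j))
    + Sum_any (\<lambda>p. Sum_any (\<lambda>r. nijenhuis A u p j k * A u i r * A u r p))"

text \<open>The right-hand side of the equation for \<open>u k\<close>, with \<open>w\<close> in the role of the derivative of \<open>u\<close>
  with respect to \<open>x\<close>.\<close>

definition chain_rhs :: "(int \<Rightarrow> 'a) \<Rightarrow> (int \<Rightarrow> 'a) \<Rightarrow> int \<Rightarrow> 'a :: real_normed_field" where
  "chain_rhs u w k =
    (if k < 0 then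
       (of_int (k + 2) * u (k + 1) - of_int k * u (k - 1) + u 1 * u k) * w 0
       + u 0 * u k * w 1 + u 0 * w (k - 1) + u 0 * w (k + 1)
     else if k = 0 then
       u 0 * u 1 * w 0 + (u 0)\<^sup>2 * w 1 + u 0 * w (- 1)
     else if k = 1 then
       (2 * u 2 - (u 1)\<^sup>2) * w 0 - u 0 * u 1 * w 1 + u 0 * w 2
     else
       (of_int (k + 1) * u (k + 1) - of_int (k - 1) * u (k - 1) - u 1 * u k) * w 0
       - u 0 * u k * w 1 + u 0 * w (k - 1) + u 0 * w (k + 1))"

text \<open>The entry \<open>(k, j)\<close> collects every coefficient of \<open>w j\<close> in \<open>chain_rhs u w k\<close>. The indices of
  the terms may coincide (for instance \<open>k + 1 = 0\<close> if \<open>k = - 1\<close>), in which case the contributions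
  are added; see \<open>chain_rhs_eq\<close>.\<close>

definition chain_matrix :: "(int \<Rightarrow> 'a) \<Rightarrow> int \<Rightarrow> int \<Rightarrow> 'a :: real_normed_field" where
  "chain_matrix u k j =
    (if k < 0 then
       (of_int (k + 2) * u (k + 1) - of_int k * u (k - 1) + u 1 * u k) * of_bool (j = 0)
       + u 0 * u k * of_bool (j = 1) + u 0 * of_bool (j = k - 1) + u 0 * of_bool (j = k + 1)
     else if k = 0 then
       u 0 * u 1 * of_bool (j = 0) + (u 0)\<^sup>2 * of_bool (j = 1) + u 0 * of_bool (j = - 1)
     else if k = 1 then
       (2 * u 2 - (u 1)\<^sup>2) * of_bool (j = 0) - u 0 * u 1 * of_bool (j = 1) + u 0 * of_bool (j = 2)
     else
       (of_int (k + 1) * u (k + 1) - of_int (k - 1) * u (k - 1) - u 1 * u k) * of_bool (j = 0)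
       - u 0 * u k * of_bool (j = 1) + u 0 * of_bool (j = k - 1) + u 0 * of_bool (j = k + 1))"

definition chain_nbhd :: "int \<Rightarrow> int set" where
  "chain_nbhd k = {0, 1, k - 1, k, k + 1}"

lemma finite_chain_nbhd [simp]: "finite (chain_nbhd k)"
  by (simp add: chain_nbhd_def)

lemma chain_matrix_nonzero: "chain_matrix u k j \<noteq> 0 \<Longrightarrow> j \<in> chain_nbhd k"
  by (auto simp: chain_matrix_def chain_nbhd_def split: if_splits)

lemma chain_matrix_upd: "p \<notin> chain_nbhd k \<Longrightarrow> chain_matrix (u(p := s)) k j = chain_matrix u k j"
  by (auto simp: chain_matrix_def chain_nbhd_def)

lemma chain_matrix_differentiable:
  "(\<lambda>s. chain_matrix (u(p := s)) k j) field_differentiable at x"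
proof -
  have upd: "(\<lambda>s. (u(p := s)) l) field_differentiable at x" for l
    by (cases "l = p") (simp_all add: field_differentiable_ident field_differentiable_const)
  have cond: "(\<lambda>s. if c then f s else g s) field_differentiable at x"
    if "f field_differentiable at x" "g field_differentiable at x" for c and f g :: "'a \<Rightarrow> 'a"
    using that by (cases c) simp_all
  show ?thesis
    unfolding chain_matrix_def power2_eq_square
    by (intro cond upd field_differentiable_add field_differentiable_diff field_differentiable_mult
        field_differentiable_const)
qed

lemma partial_chain_matrix_nonzero:
  assumes "partial p (\<lambda>v. chain_matrix v k j) u \<noteq> 0"
  shows "p \<in> chain_nbhd k" "j \<in> chain_nbhd k"
proof -
  show "p \<in> chain_nbhd k"
    using assms by (rule contrapos_np) (simp add: partial_def chain_matrix_upd)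
  show "j \<in> chain_nbhd k"
  proof (rule ccontr)
    assume "j \<notin> chain_nbhd k"
    hence "chain_matrix v k j = 0" for v :: "int \<Rightarrow> 'a"
      using chain_matrix_nonzero by blast
    thus False using assms by (simp add: partial_def)
  qed
qed

lemma chain_rhs_eq: "chain_rhs u w k = Sum_any (\<lambda>j. chain_matrix u k j * w j)"
proof -
  have "Sum_any (\<lambda>j. chain_matrix u k j * w j)
      = (\<Sum>j\<in>chain_nbhd k \<union> {- 1, 2}. chain_matrix u k j * w j)"
    by (rule Sum_any.expand_superset) (use chain_matrix_nonzero in auto)
  also have "\<dots> = chain_rhs u w k"
  proof -
    let ?S = "chain_nbhd k \<union> {- 1, 2}"
    have *: "(\<Sum>j\<in>?S. c * of_bool (j = l) * w j) = c * w l" if "l \<in> ?S" for c :: 'a and l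
    proof -
      have "(\<Sum>j\<in>?S. c * of_bool (j = l) * w j) = (\<Sum>j\<in>?S. if j = l then c * w l else 0)"
        by (rule sum.cong) auto
      also have "\<dots> = c * w l"
        using that by (subst sum.delta) auto
      finally show ?thesis .
    qed
    have m: "0 \<in> ?S" "1 \<in> ?S" "- 1 \<in> ?S" "2 \<in> ?S" "k - 1 \<in> ?S" "k + 1 \<in> ?S"
      by (auto simp: chain_nbhd_def)
    have sum3: "(\<Sum>j\<in>?S. (c * of_bool (j = l) + d * of_bool (j = l') + e * of_bool (j = m)) * w j)
        = c * w l + d * w l' + e * w m"
      if "l \<in> ?S" "l' \<in> ?S" "m \<in> ?S" for c d e :: 'a and l l' m
      unfolding distrib_right sum.distrib *[OF that(1)] *[OF that(2)] *[OF that(3)] ..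
    have sum4: "(\<Sum>j\<in>?S. (c * of_bool (j = l) + d * of_bool (j = l') + e * of_bool (j = m)
          + f * of_bool (j = n)) * w j) = c * w l + d * w l' + e * w m + f * w n"
      if "l \<in> ?S" "l' \<in> ?S" "m \<in> ?S" "n \<in> ?S" for c d e f :: 'a and l l' m n
      unfolding distrib_right sum.distrib *[OF that(1)] *[OF that(2)] *[OF that(3)] *[OF that(4)] ..
    consider "k < 0" | "k = 0" | "k = 1" | "k > 1" by linarith
    thus ?thesis
    proof cases
      case 1
      show ?thesis
        unfolding chain_matrix_def chain_rhs_def if_P[OF 1] by (rule sum4[OF m(1,2,5,6)])
    next
      case 2
      hence "\<not> k < 0" by simp
      show ?thesis
        unfolding chain_matrix_def chain_rhs_def if_not_P[OF \<open>\<not> k < 0\<close>] if_P[OF 2]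
        by (rule sum3[OF m(1,2,3)])
    next
      case 3
      hence "\<not> k < 0" "k \<noteq> 0" by simp_all
      show ?thesis
        unfolding chain_matrix_def chain_rhs_def if_not_P[OF \<open>\<not> k < 0\<close>] if_not_P[OF \<open>k \<noteq> 0\<close>] if_P[OF 3]
        using sum3[OF m(1,2,4), of "2 * u 2 - (u 1)\<^sup>2" "- (u 0 * u 1)" "u 0"] by simp
    next
      case 4
      hence "\<not> k < 0" "k \<noteq> 0" "k \<noteq> 1" by simp_all
      show ?thesis
        unfolding chain_matrix_def chain_rhs_def if_not_P[OF \<open>\<not> k < 0\<close>] if_not_P[OF \<open>k \<noteq> 0\<close>]
          if_not_P[OF \<open>k \<noteq> 1\<close>]
        using sum4[OF m(1,2,5,6), of
            "of_int (k + 1) * u (k + 1) - of_int (k - 1) * u (k - 1) - u 1 * u k" "- (u 0 * u k)" "u 0" "u 0"]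
        by (simp del: of_int_add of_int_diff)
    qed
  qed
  finally show ?thesis by simp
qed

lemma finite_nijenhuis_sums:
  "finite {p. chain_matrix u p j * partial p (\<lambda>v. chain_matrix v i k) u \<noteq> 0}"
  "finite {p. chain_matrix u i p *
     (partial j (\<lambda>v. chain_matrix v p k) u - partial k (\<lambda>v. chain_matrix v p j) u) \<noteq> 0}"
proof -
  have "p \<in> chain_nbhd i" if "partial p (\<lambda>v. chain_matrix v i k) u \<noteq> 0" for p
    using partial_chain_matrix_nonzero(1)[OF that] .
  thus "finite {p. chain_matrix u p j * partial p (\<lambda>v. chain_matrix v i k) u \<noteq> 0}"
    by (intro finite_subset[OF _ finite_chain_nbhd[of i]]) auto
  have "p \<in> chain_nbhd i" if "chain_matrix u i p \<noteq> 0" for p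
    using chain_matrix_nonzero[OF that] .
  thus "finite {p. chain_matrix u i p *
     (partial j (\<lambda>v. chain_matrix v p k) u - partial k (\<lambda>v. chain_matrix v p j) u) \<noteq> 0}"
    by (intro finite_subset[OF _ finite_chain_nbhd[of i]]) auto
qed

definition chain_nbhd2 :: "int \<Rightarrow> int set" where
  "chain_nbhd2 k = chain_nbhd k \<union> (\<Union>p\<in>chain_nbhd k. chain_nbhd p)"

lemma finite_chain_nbhd2 [simp]: "finite (chain_nbhd2 k)"
  by (simp add: chain_nbhd2_def)

lemma nijenhuis_chain_nonzero:
  assumes "nijenhuis chain_matrix u i j k \<noteq> 0"
  shows "j \<in> chain_nbhd2 i \<and> k \<in> chain_nbhd2 i"
proof (rule ccontr)
  assume n: "\<not> ?thesis"
  have 1: "chain_matrix u p j * partial p (\<lambda>v. chain_matrix v i k) u = 0" for p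
    using n chain_matrix_nonzero[of u p j] partial_chain_matrix_nonzero[of p i k u]
    by (auto simp: chain_nbhd2_def)
  have 2: "chain_matrix u p k * partial p (\<lambda>v. chain_matrix v i j) u = 0" for p
    using n chain_matrix_nonzero[of u p k] partial_chain_matrix_nonzero[of p i j u]
    by (auto simp: chain_nbhd2_def)
  have 3: "chain_matrix u i p *
     (partial j (\<lambda>v. chain_matrix v p k) u - partial k (\<lambda>v. chain_matrix v p j) u) = 0" for p
    using n chain_matrix_nonzero[of u i p] partial_chain_matrix_nonzero[of j p k u]
      partial_chain_matrix_nonzero[of k p j u]
    by (fastforce simp: chain_nbhd2_def)
  show False
    using assms unfolding nijenhuis_def 1 2 3 by simp
qed

lemma finite_haantjes_sums:
  fixes u :: "int \<Rightarrow> 'a :: real_normed_field"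
  defines "A \<equiv> chain_matrix" and "N \<equiv> nijenhuis chain_matrix u"
  shows "finite {(p, r). N i p r * A u p j * A u r k \<noteq> 0}"
    and "finite {(p, r). N p j r * A u i p * A u r k \<noteq> 0}"
    and "finite {(p, r). N p r k * A u i p * A u r j \<noteq> 0}"
    and "finite {(p, r). N p j k * A u i r * A u r p \<noteq> 0}"
proof -
  let ?F = "chain_nbhd2 i \<union> (\<Union>p\<in>chain_nbhd i. chain_nbhd2 p)"
  have fin: "finite (?F \<times> ?F)" by simp
  have sub: "chain_nbhd i \<subseteq> ?F" by (auto simp: chain_nbhd2_def)
  show "finite {(p, r). N i p r * A u p j * A u r k \<noteq> 0}"
    by (rule finite_subset[OF _ fin])
       (use sub in \<open>auto simp: A_def N_def dest!: nijenhuis_chain_nonzero\<close>)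
  show "finite {(p, r). N p j r * A u i p * A u r k \<noteq> 0}"
    by (rule finite_subset[OF _ fin])
       (use sub in \<open>auto simp: A_def N_def dest!: nijenhuis_chain_nonzero chain_matrix_nonzero[of u i]\<close>)
  show "finite {(p, r). N p r k * A u i p * A u r j \<noteq> 0}"
    by (rule finite_subset[OF _ fin])
       (use sub in \<open>auto simp: A_def N_def dest!: nijenhuis_chain_nonzero chain_matrix_nonzero[of u i]\<close>)
  show "finite {(p, r). N p j k * A u i r * A u r p \<noteq> 0}"
    by (rule finite_subset[OF _ fin])
       (auto simp: A_def chain_nbhd2_def dest!: chain_matrix_nonzero)
qed

end

theory Submission
  imports Defs
begin

text \<open>
  Write the system as \<open>A v = u\<^sup>0 S v + v\<^sup>0 Q u + (u\<^sup>0 v\<^sup>1 + u\<^sup>1 v\<^sup>0) Y u\<close>, where the constant operators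
  \<open>S\<close>, \<open>Q\<close>, \<open>Y\<close> do not mix the components of index at most 0 with those of index at least 1.
  Here \<open>Y\<close> is an involution commuting with \<open>S\<close> and \<open>Q\<close>, and \<open>Q S - S Q = 4 - S\<^sup>2\<close> up to a
  multiple of \<open>v\<^sup>0\<close> that is invisible after antisymmetrization. These relations collapse
  the Nijenhuis tensor to
  \<open>N(v, w) = \<theta>(v) A w - \<theta>(w) A v + 4 u\<^sup>0 (w\<^sup>0 v - v\<^sup>0 w)\<close> for a linear form \<open>\<theta>\<close>, and every tensor of
  this shape is annihilated by the passage from \<open>N\<close> to the Haantjes tensor.
\<close>

section \<open>Linear forms in finitely many coordinates\<close>

definition unit_seq :: "int \<Rightarrow> int \<Rightarrow> 'a :: real_normed_field" where
  "unit_seq j = (\<lambda>p. of_bool (j = p))"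

text \<open>Linearity is encoded as expansion over unit vectors, so that contracting an index
  becomes substituting a vector. Finite support is demanded separately because
  \<open>Sum_any\<close> is 0 on infinite supports.\<close>

definition fin_linear :: "((int \<Rightarrow> 'a) \<Rightarrow> 'a :: real_normed_field) \<Rightarrow> bool" where
  "fin_linear L \<longleftrightarrow> finite {p. L (unit_seq p) \<noteq> 0} \<and> (\<forall>v. L v = Sum_any (\<lambda>p. v p * L (unit_seq p)))"

lemma fin_linear_support: "fin_linear L \<Longrightarrow> finite {p. L (unit_seq p) \<noteq> 0}"
  unfolding fin_linear_def by (rule conjunct1)

lemma fin_linear_finite: "fin_linear L \<Longrightarrow> finite {p. v p * L (unit_seq p) \<noteq> 0}"
  by (drule fin_linear_support, erule rev_finite_subset) auto

lemma fin_linear_expand: "fin_linear L \<Longrightarrow> Sum_any (\<lambda>p. v p * L (unit_seq p)) = L v"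
  unfolding fin_linear_def by (elim conjE) (drule spec[of _ v], erule sym)

lemma fin_linear_zero: "fin_linear (\<lambda>v. 0)"
  by (simp add: fin_linear_def)

lemma fin_linear_eval: "fin_linear (\<lambda>v. v l)"
proof -
  have "Sum_any (\<lambda>p. v p * of_bool (p = l)) = (\<Sum>p\<in>{l}. v p * of_bool (p = l))" for v :: "int \<Rightarrow> 'a"
    by (rule Sum_any.expand_superset) auto
  thus ?thesis
    by (auto simp: fin_linear_def unit_seq_def)
qed

lemma fin_linear_add:
  assumes "fin_linear L" "fin_linear M"
  shows "fin_linear (\<lambda>v. L v + M v)"
  unfolding fin_linear_def
proof (intro conjI allI)
  show "finite {p. L (unit_seq p) + M (unit_seq p) \<noteq> 0}"
    by (rule finite_subset[OF _ finite_UnI[OF assms[THEN fin_linear_support]]]) auto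
  show "L v + M v = Sum_any (\<lambda>p. v p * (L (unit_seq p) + M (unit_seq p)))" for v
    unfolding distrib_left Sum_any.distrib[OF fin_linear_finite[OF assms(1)] fin_linear_finite[OF assms(2)]]
    by (simp add: fin_linear_expand assms)
qed

lemma fin_linear_mult_left:
  assumes "fin_linear L"
  shows "fin_linear (\<lambda>v. c * L v)"
  unfolding fin_linear_def
proof (intro conjI allI)
  show "finite {p. c * L (unit_seq p) \<noteq> 0}"
    by (rule finite_subset[OF _ fin_linear_support[OF assms]]) auto
  show "c * L v = Sum_any (\<lambda>p. v p * (c * L (unit_seq p)))" for v
    unfolding fin_linear_expand[OF assms, of v, symmetric]
      Sum_any_right_distrib[OF fin_linear_finite[OF assms]]
    by (simp add: mult.left_commute)
qed

lemma fin_linear_mult_right: "fin_linear L \<Longrightarrow> fin_linear (\<lambda>v. L v * c)"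
  using fin_linear_mult_left[of L c] by (simp add: mult.commute)

lemma fin_linear_uminus: "fin_linear L \<Longrightarrow> fin_linear (\<lambda>v. - L v)"
  using fin_linear_mult_left[of L "- 1"] by simp

lemma fin_linear_diff: "fin_linear L \<Longrightarrow> fin_linear M \<Longrightarrow> fin_linear (\<lambda>v. L v - M v)"
  using fin_linear_add[of L "\<lambda>v. - M v"] by (simp add: fin_linear_uminus)

lemma fin_linear_if:
  "fin_linear L \<Longrightarrow> fin_linear M \<Longrightarrow> fin_linear (\<lambda>v. if c then L v else M v)"
  by (cases c) simp_all

text \<open>Changing one coordinate adds a multiple of a unit vector, so the form is affine in
  \<open>s\<close>; this yields its derivative.\<close>

lemma fin_linear_upd:
  assumes "fin_linear L"
  shows "L (u(p := s)) = L u + (s - u p) * L (unit_seq p)"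
proof -
  have "L (u(p := s))
      = Sum_any (\<lambda>q. u q * L (unit_seq q) + ((s - u p) * of_bool (q = p)) * L (unit_seq q))"
    unfolding fin_linear_expand[OF assms, of "u(p := s)", symmetric]
    by (rule Sum_any.cong) (auto simp: algebra_simps)
  also have "\<dots> = L u + Sum_any (\<lambda>q. ((s - u p) * of_bool (q = p)) * L (unit_seq q))"
    unfolding Sum_any.distrib[OF fin_linear_finite[OF assms] fin_linear_finite[OF assms]]
      fin_linear_expand[OF assms] ..
  also have "Sum_any (\<lambda>q. ((s - u p) * of_bool (q = p)) * L (unit_seq q))
      = (\<Sum>q\<in>{p}. ((s - u p) * of_bool (q = p)) * L (unit_seq q))"
    by (rule Sum_any.expand_superset) auto
  also have "\<dots> = (s - u p) * L (unit_seq p)" by simp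
  finally show ?thesis .
qed

lemma fin_linear_has_field_derivative:
  assumes "fin_linear L"
  shows "((\<lambda>s. L (u(p := s))) has_field_derivative L (unit_seq p)) (at x within X)"
proof -
  have "((\<lambda>s. a + (s - b) * c) has_field_derivative c) (at x within X)" for a b c :: 'a
    by (auto intro!: derivative_eq_intros)
  thus ?thesis
    unfolding fin_linear_upd[OF assms] .
qed

section \<open>The operators S, Q, Y and their relations\<close>

definition opS :: "(int \<Rightarrow> 'a) \<Rightarrow> int \<Rightarrow> 'a :: real_normed_field" where
  "opS v k = (if k = 0 then v (- 1) else if k = 1 then v 2 else v (k - 1) + v (k + 1))"

definition opQ :: "(int \<Rightarrow> 'a) \<Rightarrow> int \<Rightarrow> 'a :: real_normed_field" where
  "opQ v k =
    (if k < 0 then of_int (k + 2) * v (k + 1) - of_int k * v (k - 1)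
     else if k = 0 then 0
     else of_int (k + 1) * v (k + 1) - of_int (k - 1) * v (k - 1))"

definition opY :: "(int \<Rightarrow> 'a) \<Rightarrow> int \<Rightarrow> 'a :: real_normed_field" where
  "opY v k = (if k \<le> 0 then v k else - v k)"

text \<open>A general inner \<open>f\<close> lets such rules be chained through compositions;
  \<open>chain_rhs\<close> applied twice needs this.\<close>

lemma fin_linear_opS: "(\<And>l. fin_linear (\<lambda>v. f v l)) \<Longrightarrow> fin_linear (\<lambda>v. opS (f v) k)"
  unfolding opS_def by (intro fin_linear_if fin_linear_add)

lemma fin_linear_opQ: "(\<And>l. fin_linear (\<lambda>v. f v l)) \<Longrightarrow> fin_linear (\<lambda>v. opQ (f v) k)"
  unfolding opQ_def
  by (intro fin_linear_if fin_linear_diff fin_linear_mult_left fin_linear_zero)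

lemma fin_linear_opY: "(\<And>l. fin_linear (\<lambda>v. f v l)) \<Longrightarrow> fin_linear (\<lambda>v. opY (f v) k)"
  unfolding opY_def by (intro fin_linear_if fin_linear_uminus)

lemma opS_linear:
  "opS (\<lambda>p. f p + g p) k = opS f k + opS g k"
  "opS (\<lambda>p. f p - g p) k = opS f k - opS g k"
  "opS (\<lambda>p. c * f p) k = c * opS f k"
  by (auto simp: opS_def algebra_simps)

lemma opQ_linear:
  "opQ (\<lambda>p. f p + g p) k = opQ f k + opQ g k"
  "opQ (\<lambda>p. f p - g p) k = opQ f k - opQ g k"
  "opQ (\<lambda>p. c * f p) k = c * opQ f k"
  by (auto simp: opQ_def algebra_simps)

lemma opY_linear:
  "opY (\<lambda>p. f p + g p) k = opY f k + opY g k"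
  "opY (\<lambda>p. f p - g p) k = opY f k - opY g k"
  "opY (\<lambda>p. c * f p) k = c * opY f k"
  by (auto simp: opY_def algebra_simps)

lemma opY_opY: "opY (opY v) k = v k"
  by (simp add: opY_def)

lemma opS_opY: "opS (opY v) k = opY (opS v) k"
  by (auto simp: opS_def opY_def)

lemma opQ_opY: "opQ (opY v) k = opY (opQ v) k"
  by (auto simp: opQ_def opY_def)

text \<open>The correction at \<open>k = 0\<close> stems from row 0 of Q being zero. In the
  Nijenhuis tensor it is multiplied by \<open>w 0\<close>, hence symmetric in \<open>v\<close> and
  \<open>w\<close>, and cancels.\<close>

lemma opQ_opS:
  "opQ (opS v) k = opS (opQ v) k - opS (opS v) k + 4 * v k - 4 * v 0 * of_bool (k = 0)"
proof -
  \<comment> \<open>For k from -1 to 2 a neighbour of k is one of the rows 0 and 1, where S is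
    truncated.\<close>
  consider "k < - 1" | "k = - 1" | "k = 0" | "k = 1" | "k = 2" | "k > 2" by linarith
  thus ?thesis
    by cases (simp_all add: opQ_def opS_def algebra_simps)
qed

lemma chain_rhs_operators:
  "chain_rhs u w k = u 0 * opS w k + w 0 * opQ u k + (u 0 * w 1 + u 1 * w 0) * opY u k"
proof -
  consider "k < 0" | "k = 0" | "k = 1" | "k > 1" by linarith
  thus ?thesis
    by cases (simp_all add: chain_rhs_def opS_def opQ_def opY_def algebra_simps power2_eq_square)
qed

lemma chain_rhs_linear:
  "chain_rhs u (\<lambda>p. f p + g p) k = chain_rhs u f k + chain_rhs u g k"
  "chain_rhs u (\<lambda>p. f p - g p) k = chain_rhs u f k - chain_rhs u g k"
  "chain_rhs u (\<lambda>p. c * f p) k = c * chain_rhs u f k"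
  by (simp_all add: chain_rhs_operators opS_linear algebra_simps)

lemma fin_linear_chain_rhs:
  assumes "\<And>l. fin_linear (\<lambda>v. f v l)"
  shows "fin_linear (\<lambda>v. chain_rhs u (f v) k)"
  unfolding chain_rhs_operators
  by (intro fin_linear_add fin_linear_mult_left fin_linear_mult_right fin_linear_opS assms)

text \<open>Reflexivity suffices since \<open>unit_seq\<close> orients its equality as
  \<open>chain_matrix\<close> does.\<close>

lemma chain_matrix_eq_chain_rhs: "chain_matrix u k j = chain_rhs u (unit_seq j) k"
  unfolding chain_matrix_def chain_rhs_def unit_seq_def ..

section \<open>Directional derivatives and the Nijenhuis tensor\<close>

definition dchain :: "(int \<Rightarrow> 'a) \<Rightarrow> (int \<Rightarrow> 'a) \<Rightarrow> (int \<Rightarrow> 'a) \<Rightarrow> int \<Rightarrow> 'a :: real_normed_field" where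
  "dchain u v w k = v 0 * opS w k + w 0 * opQ v k + (v 0 * w 1 + v 1 * w 0) * opY u k
     + (u 0 * w 1 + u 1 * w 0) * opY v k"

lemma fin_linear_dchain: "fin_linear (\<lambda>v. dchain u v w k)"
  unfolding dchain_def
  by (intro fin_linear_add fin_linear_mult_left fin_linear_mult_right fin_linear_opQ fin_linear_opY
      fin_linear_eval)

text \<open>By the product rule, \<open>dchain u v w\<close> is the derivative of
  \<open>chain_rhs u w\<close> in \<open>u\<close> along \<open>v\<close>, with \<open>w\<close>
  fixed.\<close>

lemma partial_chain_rhs: "partial p (\<lambda>v. chain_rhs v w k) u = dchain u (unit_seq p) w k"
proof -
  have "((\<lambda>s. chain_rhs (u(p := s)) w k) has_field_derivative dchain u (unit_seq p) w k) (at (u p))"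
    unfolding chain_rhs_operators
    by (rule derivative_eq_intros fin_linear_has_field_derivative fin_linear_opQ fin_linear_opY
        fin_linear_eval refl)+ (simp add: dchain_def algebra_simps)
  thus ?thesis
    unfolding partial_def by (rule DERIV_imp_deriv)
qed

text \<open>This is row 0 of the matrix with its common factor \<open>u 0\<close> removed:
  \<open>chain_rhs u v 0 = u 0 * theta u v\<close>. No division occurs, so \<open>u 0 = 0\<close> is
  allowed.\<close>

definition theta :: "(int \<Rightarrow> 'a) \<Rightarrow> (int \<Rightarrow> 'a) \<Rightarrow> 'a :: real_normed_field" where
  "theta u v = v (- 1) + u 0 * v 1 + u 1 * v 0"

definition nij_form :: "(int \<Rightarrow> 'a) \<Rightarrow> (int \<Rightarrow> 'a) \<Rightarrow> (int \<Rightarrow> 'a) \<Rightarrow> int \<Rightarrow> 'a :: real_normed_field" where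
  "nij_form u v w i = theta u v * chain_rhs u w i - theta u w * chain_rhs u v i
     + 4 * u 0 * (w 0 * v i - v 0 * w i)"

lemma nij_form_dchain:
  "dchain u (chain_rhs u v) w i - dchain u (chain_rhs u w) v i
     - chain_rhs u (\<lambda>p. dchain u v w p - dchain u w v p) i = nij_form u v w i"
proof -
  have S0: "opS x 0 = x (- 1)" and S1: "opS x 1 = x 2" and Q0: "opQ x 0 = 0"
    and Q1: "opQ x 1 = 2 * x 2" and Y0: "opY x 0 = x 0" and Y1: "opY x 1 = - x 1" for x :: "int \<Rightarrow> 'a"
    by (simp_all add: opS_def opQ_def opY_def)
  have A: "chain_rhs u x
      = (\<lambda>k. u 0 * opS x k + x 0 * opQ u k + (u 0 * x 1 + u 1 * x 0) * opY u k)" for x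
    by (rule ext) (rule chain_rhs_operators)
  show ?thesis
    unfolding A dchain_def nij_form_def theta_def opS_linear opQ_linear opY_linear
      opY_opY opS_opY opQ_opY opQ_opS S0 S1 Q0 Q1 Y0 Y1
    by (simp add: algebra_simps)
qed

lemma nijenhuis_chain_matrix:
  "nijenhuis chain_matrix u i j k = nij_form u (unit_seq j) (unit_seq k) i"
proof -
  have D: "Sum_any (\<lambda>p. chain_rhs u v p * dchain u (unit_seq p) w i) = dchain u (chain_rhs u v) w i" for v w
    by (rule fin_linear_expand[OF fin_linear_dchain])
  show ?thesis
    \<comment> \<open>The third sum is folded first, while its matrix entries are still visible as
      \<open>chain_matrix\<close>.\<close>
    unfolding nijenhuis_def chain_rhs_eq[symmetric]
    unfolding chain_matrix_eq_chain_rhs partial_chain_rhs D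
    by (rule nij_form_dchain)
qed

section \<open>Contractions and the Haantjes tensor\<close>

lemma fin_linear_nij_form_left: "fin_linear (\<lambda>v. nij_form u v w i)"
  unfolding nij_form_def theta_def
  by (intro fin_linear_add fin_linear_diff fin_linear_mult_left fin_linear_mult_right
      fin_linear_chain_rhs fin_linear_eval)

lemma fin_linear_nij_form_right: "fin_linear (\<lambda>w. nij_form u v w i)"
  unfolding nij_form_def theta_def
  by (intro fin_linear_add fin_linear_diff fin_linear_mult_left fin_linear_mult_right
      fin_linear_chain_rhs fin_linear_eval)

text \<open>A formal cancellation: it uses only linearity of \<open>chain_rhs u\<close> and the
  shape of \<open>nij_form\<close>, whatever the values of \<open>theta\<close>.\<close>

lemma haantjes_nij_form:
  "nij_form u (chain_rhs u v) (chain_rhs u w) i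
     - chain_rhs u (nij_form u v (chain_rhs u w)) i
     - chain_rhs u (nij_form u (chain_rhs u v) w) i
     + chain_rhs u (chain_rhs u (nij_form u v w)) i = 0"
proof -
  have N: "nij_form u x y = (\<lambda>i. theta u x * chain_rhs u y i - theta u y * chain_rhs u x i
     + 4 * u 0 * (y 0 * x i - x 0 * y i))" for x y
    by (rule ext) (rule nij_form_def)
  have A: "chain_rhs u (nij_form u x y) = (\<lambda>i. theta u x * chain_rhs u (chain_rhs u y) i
     - theta u y * chain_rhs u (chain_rhs u x) i
     + 4 * u 0 * (y 0 * chain_rhs u x i - x 0 * chain_rhs u y i))" for x y
    unfolding N chain_rhs_linear ..
  show ?thesis
    \<comment> \<open>\<open>A\<close> must come first, since \<open>N\<close> destroys its
      left-hand sides.\<close>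
    unfolding A unfolding N chain_rhs_linear by (simp add: algebra_simps)
qed

theorem proposition5:
  fixes u :: "int \<Rightarrow> 'a :: real_normed_field" and i j k :: int
  shows "haantjes chain_matrix u i j k = 0"
proof -
  let ?e = "unit_seq :: int \<Rightarrow> int \<Rightarrow> 'a" and ?N = "nij_form u" and ?A = "chain_rhs u"
  \<comment> \<open>The inert middle factor \<open>c\<close> matches the order of factors in
    \<open>haantjes_def\<close>.\<close>
  have right: "Sum_any (\<lambda>r. ?N v (?e r) p * c * x r) = ?N v x p * c" for v x p c
    using fin_linear_expand[OF fin_linear_mult_right[OF fin_linear_nij_form_right[of u v p], of c], of x]
    by (simp add: mult_ac)
  have left: "Sum_any (\<lambda>r. ?N (?e r) w p * c * x r) = ?N x w p * c" for w x p c
    using fin_linear_expand[OF fin_linear_mult_right[OF fin_linear_nij_form_left[of u w p], of c], of x]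
    by (simp add: mult_ac)
  have act: "Sum_any (\<lambda>p. x p * ?A (?e p) i) = ?A x i" for x i
    by (rule fin_linear_expand[OF fin_linear_chain_rhs[OF fin_linear_eval]])
  have 1: "Sum_any (\<lambda>p. Sum_any (\<lambda>r. ?N (?e p) (?e r) i * ?A (?e j) p * ?A (?e k) r))
      = ?N (?A (?e j)) (?A (?e k)) i"
    \<comment> \<open>The outer sum has no middle factor left, hence \<open>c = 1\<close>.\<close>
    unfolding right using left[of _ _ 1] by simp
  have 2: "Sum_any (\<lambda>p. Sum_any (\<lambda>r. ?N (?e j) (?e r) p * ?A (?e p) i * ?A (?e k) r))
      = ?A (?N (?e j) (?A (?e k))) i"
    unfolding right act ..
  have 3: "Sum_any (\<lambda>p. Sum_any (\<lambda>r. ?N (?e r) (?e k) p * ?A (?e p) i * ?A (?e j) r))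
      = ?A (?N (?A (?e j)) (?e k)) i"
    unfolding left act ..
  \<comment> \<open>In the last term the sum over \<open>r\<close> squares the matrix, and the sum
    over \<open>p\<close> then applies this square to the Nijenhuis vector.\<close>
  have "Sum_any (\<lambda>r. c * ?A (?e r) i * ?A (?e p) r) = c * ?A (?A (?e p)) i" for c p
    using fin_linear_expand[OF fin_linear_mult_left[where L = "\<lambda>v. ?A v i", of c,
          OF fin_linear_chain_rhs[OF fin_linear_eval]], of "?A (?e p)"]
    by (simp add: mult_ac)
  moreover have "Sum_any (\<lambda>p. x p * ?A (?A (?e p)) i) = ?A (?A x) i" for x
    by (rule fin_linear_expand[OF fin_linear_chain_rhs[OF fin_linear_chain_rhs[OF fin_linear_eval]]])
  ultimately have 4: "Sum_any (\<lambda>p. Sum_any (\<lambda>r. ?N (?e j) (?e k) p * ?A (?e r) i * ?A (?e p) r))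
      = ?A (?A (?N (?e j) (?e k))) i"
    by simp
  show ?thesis
    unfolding haantjes_def nijenhuis_chain_matrix chain_matrix_eq_chain_rhs 1 2 3 4
    by (rule haantjes_nij_form)
qed

end
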